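(* Consider the system $$\dot{\mathbf{\Delta V}}=-\mathbb{Q}\mathbf{V}-\mathbb{L}D\mathbf{I_L},\qquad \dot{\mathbf{V}}=\Omega\mathbf{\Delta V}-\Omega\mathbf{V}+\Omega\mathbf{V_{ref}},$$ with $\mathbb{Q}=\mathbb{L}D\mathbb{M}$, $\Omega=\omega_cI$, $\omega_c>0$, and constant inputs $\mathbf{I_L}=\mathbf{I_L^*}\in\mathbb{R}^N$, $\mathbf{V_{ref}}=\mathbf{V_{ref}^*}\in\mathbb{R}^N$. At every equilibrium $[\mathbf{\Delta V^*}^T,\mathbf{V^*}^T]^T$, current sharing is achieved: the corresponding output currents $\mathbf{I_t^*}=[I_{t1}^*,\dots,I_{tN}^*]^T$ satisfy $\frac{I_{ti}^*}{I_{ti}^s}=\frac{I_{tj}^*}{I_{tj}^s}$ for all $i,j\in\{1,\dots,N\}$. Moreover, writing the equilibrium as $\mathbf{\Delta V^*}=\mathbf{\widehat{\Delta V}^*}+\alpha\mathbf{1}_N$, $\mathbf{V^*}=\mathbf{\widehat{\Delta V}^*}+\alpha\mathbf{1}_N+\mathbf{V_{ref}^*}$ with $\mathbf{\widehat{\Delta V}^*}\in H^1$ and $\alpha\in\mathbb{R}$, if $\mathbf{V_{ref}^*}=V_{ref}\mathbf{1}_N$ for some $V_{ref}\in\mathbb{R}$ and $\alpha=0$, then the equilibrium satisfies voltage balancing: $\langle\mathbf{V^*}\rangle=V_{ref}$.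
   Context: $\mathcal{G}_c$ is an undirected connected graph with node set $\{1,\dots,N\}$ and edge weights $a_{ij}=a_{ji}>0$; $\mathbb{L}=k_I\mathcal{L}(\mathcal{G}_c)$ with $k_I>0$ a constant. $\mathcal{G}_{el}$ is a weakly connected directed graph with the same node set, incidence matrix $B_{el}$ and diagonal matrix $W$ of positive edge weights; $\mathbb{M}=\mathcal{L}(\mathcal{G}_{el})=B_{el}WB_{el}^T$. The Laplacian of a weighted (di)graph with incidence matrix $B$ and diagonal matrix $W$ of edge weights is $\mathcal{L}=BWB^T$. $D=\mathrm{diag}\left(\frac1{I_{t1}^s},\dots,\frac1{I_{tN}^s}\right)$ with scaling factors $I_{ti}^s>0$. The first equation arises from $\dot{\mathbf{\Delta V}}=-\mathbb{L}D\mathbf{I_t}$, where the line currents are $\mathbf{I_\ell}=-WB_{el}^T\mathbf{V}$ and the output currents are $\mathbf{I_t}=\mathbf{I_L}-B_{el}\mathbf{I_\ell}$, i.e. $\mathbf{I_t}=\mathbf{I_L}+\mathbb{M}\mathbf{V}$. $\langle v\rangle=\frac1N\sum_i v_i$ and $H^1=\{v\in\mathbb{R}^N:\langle v\rangle=0\}$. It is known that the equilibria for given constant inputs have the form used in the claim, where $\mathbf{\widehat{\Delta V}^*}$ is the unique solution in $H^1$ of $\mathbb{Q}x=-\mathbb{L}D\mathbf{I_L^*}-\mathbb{Q}\mathbf{V_{ref}^*}$. *)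

theory Defs
  imports "HOL-Analysis.Analysis" "Graph_Theory.Graph_Theory"
begin

definition diag_matrix :: "('m::finite \<Rightarrow> real) \<Rightarrow> real ^ 'm ^ 'm" where
  "diag_matrix d = (\<chi> i j. if i = j then d i else 0)"

text \<open>
  Columns are indexed by all pairs of nodes; the columns of pairs that are not arcs are zero,
  so they contribute nothing to any product below, whatever weight the pair carries.
  This also covers graphs without arcs (a single node).
\<close>
definition incidence_matrix :: "'n::finite pair_pre_digraph \<Rightarrow> real ^ ('n \<times> 'n) ^ 'n" where
  "incidence_matrix G =
     (\<chi> i e. if e \<in> parcs G
             then (if i = snd e then 1 else 0) - (if i = fst e then 1 else 0)
             else 0)"

definition laplacian :: "'n::finite pair_pre_digraph \<Rightarrow> ('n \<times> 'n \<Rightarrow> real) \<Rightarrow> real ^ 'n ^ 'n" where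
  "laplacian G w = incidence_matrix G ** diag_matrix w ** transpose (incidence_matrix G)"

text \<open>
  An undirected graph is a symmetric digraph. Its incidence matrix has one column per
  undirected edge, i.e. it is the incidence matrix of an orientation, which selects exactly
  one of the two arcs of every edge. (Using both arcs would double the Laplacian.)
\<close>
definition is_orientation :: "'n pair_pre_digraph \<Rightarrow> 'n pair_pre_digraph \<Rightarrow> bool" where
  "is_orientation H G \<longleftrightarrow>
     pverts H = pverts G \<and>
     parcs H \<union> (parcs H)\<inverse> = parcs G \<and>
     parcs H \<inter> (parcs H)\<inverse> = {}"

definition line_currents ::
  "'n::finite pair_pre_digraph \<Rightarrow> ('n \<times> 'n \<Rightarrow> real) \<Rightarrow> real ^ 'n \<Rightarrow> real ^ ('n \<times> 'n)" where
  "line_currents G w V = - ((diag_matrix w ** transpose (incidence_matrix G)) *v V)"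

definition output_currents ::
  "'n::finite pair_pre_digraph \<Rightarrow> ('n \<times> 'n \<Rightarrow> real) \<Rightarrow> real ^ 'n \<Rightarrow> real ^ 'n \<Rightarrow> real ^ 'n" where
  "output_currents G w I\<^sub>L V = I\<^sub>L - incidence_matrix G *v line_currents G w V"

definition mean :: "real ^ 'n::finite \<Rightarrow> real" where
  "mean v = (\<Sum>i\<in>UNIV. v $ i) / real CARD('n)"

definition H1 :: "(real ^ 'n::finite) set" where
  "H1 = {v. mean v = 0}"

text \<open>Equilibrium of the autonomous system with vector field \<open>f\<close>.\<close>
definition equilibrium :: "('a::real_normed_vector \<Rightarrow> 'a) \<Rightarrow> 'a \<Rightarrow> bool" where
  "equilibrium f x \<longleftrightarrow> f x = 0"

end

theory Submission
  imports Defs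
begin

text \<open>
  At an equilibrium the vector \<open>D I\<^sub>t\<close> of scaled output currents lies in the kernel of the
  communication Laplacian. Since \<open>x\<^sup>T B W B\<^sup>T x\<close> is the weighted sum of the squared differences of
  \<open>x\<close> along the edges, the kernel of the Laplacian of a connected graph consists of the constant
  vectors.
\<close>

lemma diag_matrix_vector_mult: "diag_matrix d *v x = (\<chi> i. d i * x $ i)"
  by (simp add: diag_matrix_def matrix_vector_mult_def vec_eq_iff mult_delta_left)

lemma vector_incidence_matrix_mult:
  "(x v* incidence_matrix G) $ e = (if e \<in> parcs G then x $ snd e - x $ fst e else 0)"
  by (simp add: incidence_matrix_def vector_matrix_mult_def right_diff_distrib
      sum_subtractf mult_delta_right)

text \<open>Moving the left incidence factor across the inner product makes both arguments the
  vector of differences of \<open>x\<close> along arcs, one of them weighted by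
  \<open>w\<close>.\<close>

lemma laplacian_quadratic_form:
  "x \<bullet> (laplacian G w *v x) = (\<Sum>e\<in>parcs G. w e * (x $ snd e - x $ fst e)\<^sup>2)"
proof -
  let ?B = "incidence_matrix G"
  have "x \<bullet> (laplacian G w *v x) = (x v* ?B) \<bullet> (diag_matrix w *v (x v* ?B))"
    by (simp add: laplacian_def dot_lmul_matrix [symmetric] flip: matrix_vector_mul_assoc)
  \<comment> \<open>Columns are indexed by all pairs of nodes; those of non-arcs vanish, so no sign
    of \<open>w\<close> matters there.\<close>
  also have "\<dots> = (\<Sum>e\<in>UNIV. if e \<in> parcs G then w e * (x $ snd e - x $ fst e)\<^sup>2 else 0)"
    by (auto simp: inner_vec_def diag_matrix_vector_mult vector_incidence_matrix_mult
        power2_eq_square intro!: sum.cong)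
  finally show ?thesis
    by (simp add: sum.If_cases)
qed

text \<open>A kernel vector makes the quadratic form zero; with positive weights this is a sum of
  nonnegative terms, so every term vanishes.\<close>

lemma laplacian_kernel_arc:
  assumes pos: "\<And>e. e \<in> parcs G \<Longrightarrow> w e > 0"
    and ker: "laplacian G w *v x = 0"
    and arc: "(u, v) \<in> parcs G"
  shows "x $ u = x $ v"
proof -
  have "(\<Sum>e\<in>parcs G. w e * (x $ snd e - x $ fst e)\<^sup>2) = 0"
    using laplacian_quadratic_form [of x G w] ker by simp
  then have "\<forall>e\<in>parcs G. w e * (x $ snd e - x $ fst e)\<^sup>2 = 0"
    by (subst (asm) sum_nonneg_eq_0_iff) (auto dest!: pos)
  with arc pos [OF arc] show ?thesis
    by fastforce
qed

text \<open>Connectedness means strong connectedness of the symmetric closure. A path there may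
  cross arcs backwards, which is harmless because equality is symmetric.\<close>

lemma connected_imp_constant:
  assumes con: "Digraph_Component.connected (with_proj G)"
    and arcs: "\<And>u v. (u, v) \<in> parcs G \<Longrightarrow> f u = f v"
    and "u \<in> pverts G" and "v \<in> pverts G"
  shows "f u = f v"
proof -
  have "u \<rightarrow>\<^sup>*\<^bsub>with_proj (mk_symmetric (with_proj G))\<^esub> v"
    using con assms(3,4) by (auto simp: Digraph_Component.connected_def strongly_connected_def)
  then have "(u, v) \<in> (parcs (mk_symmetric (with_proj G)))\<^sup>*"
    using reachable_rtranclI by fastforce
  then show ?thesis
    by (induction rule: rtrancl_induct) (auto simp: parcs_mk_symmetric dest: arcs)
qed

text \<open>The minus sign in the line currents cancels the one in the current balance.\<close>

lemma output_currents_eq: "output_currents G w c V = c + laplacian G w *v V"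
  by (simp add: output_currents_def line_currents_def laplacian_def
      vec.neg matrix_vector_mul_assoc matrix_mul_assoc)

lemma mean_add: "mean (u + v) = mean u + mean v"
  by (simp add: mean_def sum.distrib add_divide_distrib)

lemma mean_scaleR_one: "mean (c *\<^sub>R 1) = c"
  by (simp add: mean_def)

theorem proposition7:
  fixes Gc Gc_or Gel :: "'n::finite pair_pre_digraph"
    and a :: "'n \<Rightarrow> 'n \<Rightarrow> real"
    and w :: "'n \<times> 'n \<Rightarrow> real"
    and Is I\<^sub>L V\<^sub>r\<^sub>e\<^sub>f :: "real ^ 'n"
    and k\<^sub>I \<omega>\<^sub>c :: real
    and L D M Q \<Omega> :: "real ^ 'n ^ 'n"
  assumes "pair_graph Gc" and "pverts Gc = UNIV" and "Digraph_Component.connected Gc"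
    and "\<And>i j. (i, j) \<in> parcs Gc \<Longrightarrow> a i j = a j i \<and> a i j > 0"
    and "is_orientation Gc_or Gc"
    and "k\<^sub>I > 0"
    and "L = k\<^sub>I *\<^sub>R laplacian Gc_or (\<lambda>(i, j). a i j)"
    and "pair_digraph Gel" and "pverts Gel = UNIV" and "Digraph_Component.connected Gel"
    and "\<And>e. e \<in> parcs Gel \<Longrightarrow> w e > 0"
    and "M = laplacian Gel w"
    and "\<And>i. Is $ i > 0"
    and "D = diag_matrix (\<lambda>i. 1 / Is $ i)"
    and "Q = L ** D ** M"
    and "\<omega>\<^sub>c > 0"
    and "\<Omega> = \<omega>\<^sub>c *\<^sub>R mat 1"
  shows "\<forall>\<Delta>V V.
    equilibrium
      (\<lambda>(\<Delta>V, V). (- (Q *v V) - (L ** D) *v I\<^sub>L, \<Omega> *v \<Delta>V - \<Omega> *v V + \<Omega> *v V\<^sub>r\<^sub>e\<^sub>f))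
      (\<Delta>V, V) \<longrightarrow>
    (\<forall>i j. output_currents Gel w I\<^sub>L V $ i / Is $ i = output_currents Gel w I\<^sub>L V $ j / Is $ j) \<and>
    (\<forall>\<Delta>V_hat \<alpha> v.
       \<Delta>V_hat \<in> H1 \<and>
       Q *v \<Delta>V_hat = - ((L ** D) *v I\<^sub>L) - Q *v V\<^sub>r\<^sub>e\<^sub>f \<and>
       \<Delta>V = \<Delta>V_hat + \<alpha> *\<^sub>R 1 \<and>
       V = \<Delta>V_hat + \<alpha> *\<^sub>R 1 + V\<^sub>r\<^sub>e\<^sub>f \<and>
       V\<^sub>r\<^sub>e\<^sub>f = v *\<^sub>R 1 \<and>
       \<alpha> = 0 \<longrightarrow>
       mean V = v)"
proof (intro allI impI conjI)
  fix \<Delta>V V i j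
  assume eq: "equilibrium
      (\<lambda>(\<Delta>V, V). (- (Q *v V) - (L ** D) *v I\<^sub>L, \<Omega> *v \<Delta>V - \<Omega> *v V + \<Omega> *v V\<^sub>r\<^sub>e\<^sub>f))
      (\<Delta>V, V)"
  \<comment> \<open>The entries of \<open>x\<close> are the ratios that current sharing requires to
    be equal.\<close>
  define x where "x = D *v output_currents Gel w I\<^sub>L V"
  have "L *v x = (L ** D) *v I\<^sub>L + Q *v V"
    by (simp add: x_def output_currents_eq assms(12,15) matrix_vector_right_distrib
        flip: matrix_vector_mul_assoc)
  \<comment> \<open>This is the \<Delta>V component of the equilibrium condition with its sign
    reversed.\<close>
  also have "\<dots> = 0"
    using eq by (auto simp: equilibrium_def zero_prod_def algebra_simps neg_eq_iff_add_eq_0)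
  \<comment> \<open>The positive factor \<open>k\<^sub>I\<close> is cancelled.\<close>
  finally have ker: "laplacian Gc_or (\<lambda>(i, j). a i j) *v x = 0"
    using assms(6,7) by (simp flip: scaleR_matrix_vector_assoc)
  have union: "parcs Gc_or \<union> (parcs Gc_or)\<inverse> = parcs Gc"
    using assms(5) by (simp add: is_orientation_def)
  \<comment> \<open>The Laplacian sees only the chosen orientation. Its arcs are arcs of
    \<open>Gc\<close>, which makes their weights positive.\<close>
  have or_arc: "x $ u = x $ v" if "(u, v) \<in> parcs Gc_or" for u v
    using laplacian_kernel_arc [OF _ ker that] assms(4) union by fastforce
  \<comment> \<open>Each arc of \<open>Gc\<close> is an oriented arc or the reverse of one.\<close>
  have arc: "x $ u = x $ v" if "(u, v) \<in> parcs Gc" for u v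
    using that or_arc [of u v] or_arc [of v u] by (auto simp flip: union)
  have "x $ i = x $ j"
    by (rule connected_imp_constant [OF assms(3) arc]) (simp_all add: assms(2))
  then show "output_currents Gel w I\<^sub>L V $ i / Is $ i = output_currents Gel w I\<^sub>L V $ j / Is $ j"
    by (simp add: x_def assms(14) diag_matrix_vector_mult)
next
  fix \<Delta>V V \<Delta>V_hat :: "real ^ 'n" and \<alpha> v :: real
  assume "\<Delta>V_hat \<in> H1 \<and>
       Q *v \<Delta>V_hat = - ((L ** D) *v I\<^sub>L) - Q *v V\<^sub>r\<^sub>e\<^sub>f \<and>
       \<Delta>V = \<Delta>V_hat + \<alpha> *\<^sub>R 1 \<and>
       V = \<Delta>V_hat + \<alpha> *\<^sub>R 1 + V\<^sub>r\<^sub>e\<^sub>f \<and>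
       V\<^sub>r\<^sub>e\<^sub>f = v *\<^sub>R 1 \<and>
       \<alpha> = 0"
  then show "mean V = v"
    \<comment> \<open>With \<alpha> zero, \<open>V\<close> is a vector of mean zero plus
      \<open>v\<close> times the all-ones vector \<open>1\<close>.\<close>
    by (simp add: mean_add mean_scaleR_one H1_def)
qed

end
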